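(* For every integer $n\ge 0$, the composite map $\psi\circ\sigma$ is a bijection between the set of $12312$-avoiding partitions of $[n+1]$ and the set of Schröder paths of semilength $n$ without peaks at even level; likewise, the composite map $\psi\circ\phi$ is a bijection between the set of $12321$-avoiding partitions of $[n+1]$ and the set of Schröder paths of semilength $n$ without peaks at even level. (The maps $\sigma,\phi,\psi$ are defined in the context.)
   Context: A partition of $[m]=\{1,\dots,m\}$ with blocks $B_1,\dots,B_k$ (nonempty, disjoint, with union $[m]$), listed so that $\min B_1<\min B_2<\cdots<\min B_k$, is represented by its canonical sequential form: the word $\pi_1\pi_2\cdots\pi_m$ on $\{1,\dots,k\}$ with $\pi_i=j$ if and only if $i\in B_j$. Partitions are identified with these words. A partition $\pi$ avoids a partition (pattern) $\tau$ if the word $\pi$ has no (not necessarily contiguous) subsequence order-isomorphic to $\tau$. A Schröder path of semilength $n$ is a lattice path from $(0,0)$ to $(2n,0)$ that never goes below the $x$-axis and consists of up steps $U=(1,1)$, down steps $D=(1,-1)$ and horizontal steps $H=(2,0)$. It is UH-free if no up step is immediately followed by a horizontal step. A peak is an up step immediately followed by a down step; its level is the larger $y$-coordinate of its up step. Definition of $\sigma$ and $\phi$. Both maps are given by the same rule; $\sigma$ has domain the $12312$-avoiding partitions of $[n+1]$, $\phi$ has domain the $12321$-avoiding partitions of $[n+1]$, and both take values in the UH-free Schröder paths of semilength $n$. The partition $\pi=1$ is sent to the empty path. Otherwise, if $\pi$ has $k$ blocks, write $\pi$ uniquely as $1w_12w_2\cdots kw_k$, where the displayed letters $1,2,\dots,k$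 are the left-to-right maxima of $\pi$ (the first occurrences of the letters) and each $w_i$ is a possibly empty word on $\{1,\dots,i\}$. For $1\le i\le k-1$ let $d_i$ be the number of occurrences of the letter $i$ to the right of the first occurrence of $i+1$. Read $\pi$ from left to right and build the path by appending steps as follows: the initial letter $1$ contributes nothing; when the left-to-right maximum $i\ge 2$ is read, append $d_{i-1}+1$ up steps followed by one down step; when a letter of $w_i$ that is less than $i$ is read, append one down step; when a letter of $w_i$ equal to $i$ is read, append one horizontal step. Definition of $\psi$ (recursive, on UH-free Schröder paths $P$). If $P$ is empty, $\psi(P)$ is empty. Otherwise: (1) if $P=HP'$ with $P'$ a possibly empty UH-free Schröder path, then $\psi(P)=H\psi(P')$; (2) if $P=UDP'$ with $P'$ a possibly empty UH-free Schröder path, then $\psi(P)=UD\psi(P')$; (3) if $P=U^kDP_1DP_2\cdots DP_k$ with $k\ge 2$, where $U^k$ denotes $k$ consecutive up steps and each $P_i$ is a possibly empty UH-free Schröder path (up to translation), then $\psi(P)=UP_1'P_2'\cdots P_{k-1}'D\psi(P_k)$, where for $1\le i\le k-1$, $P_i'=H$ if $P_i$ is empty and $P_i'=U\psi(P_i)D$ otherwise. *)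

theory Defs
  imports
    Main
    "HOL-Library.Disjoint_Sets"
    "HOL-Library.FuncSet"
    "HOL-Library.Product_Plus"
    "HOL-Library.Sublist"
begin

section \<open>Set partitions and pattern avoidance\<close>

text \<open>
  The canonical sequential forms of the partitions of \<open>{1..m}\<close>. The list \<open>Bs\<close> contains the blocks
  in increasing order of their minima; blocks, letters and elements of \<open>{1..m}\<close> are numbered
  from 1, positions in lists from 0.
\<close>
definition partition_words :: "nat \<Rightarrow> nat list set" where
  "partition_words m = {w. \<exists>Bs. partition_on {1..m} (set Bs) \<and>
      sorted_wrt (\<lambda>A B. Min A < Min B) Bs \<and>
      length w = m \<and> set w \<subseteq> {1..length Bs} \<and>
      (\<forall>i<m. \<forall>j<length Bs. w ! i = Suc j \<longleftrightarrow> Suc i \<in> Bs ! j)}"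

definition order_isomorphic :: "nat list \<Rightarrow> nat list \<Rightarrow> bool" where
  "order_isomorphic u v \<longleftrightarrow> length u = length v \<and>
     (\<forall>i<length u. \<forall>j<length u. u ! i < u ! j \<longleftrightarrow> v ! i < v ! j)"

definition avoids :: "nat list \<Rightarrow> nat list \<Rightarrow> bool" where
  "avoids w \<tau> \<longleftrightarrow> (\<nexists>u. subseq u w \<and> order_isomorphic u \<tau>)"

definition avoiding_partitions :: "nat \<Rightarrow> nat list \<Rightarrow> nat list set" where
  "avoiding_partitions m \<tau> = {w \<in> partition_words m. avoids w \<tau>}"


section \<open>Schroeder paths\<close>

datatype step = U | D | H

fun step_vector :: "step \<Rightarrow> int \<times> int" where
  "step_vector U = (1, 1)"
| "step_vector D = (1, -1)"
| "step_vector H = (2, 0)"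

definition end_point :: "step list \<Rightarrow> int \<times> int" where
  "end_point p = sum_list (map step_vector p)"

definition height :: "step list \<Rightarrow> int" where
  "height p = snd (end_point p)"

definition schroeder_paths :: "nat \<Rightarrow> step list set" where
  "schroeder_paths n = {p. end_point p = (2 * int n, 0) \<and> (\<forall>q. prefix q p \<longrightarrow> 0 \<le> height q)}"

definition UH_free :: "step list \<Rightarrow> bool" where
  "UH_free p \<longleftrightarrow> \<not> sublist [U, H] p"

text \<open>The level of the peak in \<open>p @ [U, D] @ q\<close> is the height reached after \<open>p @ [U]\<close>.\<close>
definition no_even_peak :: "step list \<Rightarrow> bool" where
  "no_even_peak P \<longleftrightarrow> (\<forall>p q. P = p @ [U, D] @ q \<longrightarrow> odd (height (p @ [U])))"

definition UH_free_schroeder :: "step list \<Rightarrow> bool" where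
  "UH_free_schroeder p \<longleftrightarrow> (\<exists>n. p \<in> schroeder_paths n) \<and> UH_free p"


section \<open>The maps from partitions to paths\<close>

text \<open>Number of occurrences of \<open>i\<close> to the right of the first occurrence of \<open>i + 1\<close>.\<close>
definition later_occurrences :: "nat list \<Rightarrow> nat \<Rightarrow> nat" where
  "later_occurrences w i = count_list (tl (dropWhile (\<lambda>x. x \<noteq> i + 1) w)) i"

text \<open>
  The steps contributed by the letter at position \<open>t\<close>. If this letter is not a left-to-right
  maximum, it belongs to the factor following the first occurrence of the maximum \<open>m\<close> of the
  preceding letters.
\<close>
definition letter_steps :: "nat list \<Rightarrow> nat \<Rightarrow> step list" where
  "letter_steps w t =
     (if t = 0 then []
      else let m = Max (set (take t w)); a = w ! t in
        if m < a then replicate (later_occurrences w (a - 1) + 1) U @ [D]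
        else if a < m then [D]
        else [H])"

definition word_path :: "nat list \<Rightarrow> step list" where
  "word_path w = concat (map (letter_steps w) [0..<length w])"

definition sigma :: "nat \<Rightarrow> nat list \<Rightarrow> step list" where
  "sigma n = restrict word_path (avoiding_partitions (n + 1) [1, 2, 3, 1, 2])"

definition phi :: "nat \<Rightarrow> nat list \<Rightarrow> step list" where
  "phi n = restrict word_path (avoiding_partitions (n + 1) [1, 2, 3, 2, 1])"


section \<open>Decomposition of UH-free Schroeder paths\<close>

lemma height_simps [simp]:
  "height [] = 0"
  "height (U # p) = 1 + height p"
  "height (D # p) = height p - 1"
  "height (H # p) = height p"
  "height (p @ q) = height p + height q"
  by (simp_all add: height_def end_point_def)

lemma height_replicate_U [simp]: "height (replicate k U) = int k"
  by (induction k) auto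

definition above :: "int \<Rightarrow> step list \<Rightarrow> bool" where
  "above h p \<longleftrightarrow> (\<forall>q. prefix q p \<longrightarrow> 0 \<le> h + height q)"

lemma above_Nil [simp]: "above h [] \<longleftrightarrow> 0 \<le> h"
  by (simp add: above_def)

lemma above_nonneg: "above h p \<Longrightarrow> 0 \<le> h"
  by (auto simp: above_def dest: spec[of _ "[]"])

lemma above_Cons: "above h (s # p) \<longleftrightarrow> 0 \<le> h \<and> above (h + height [s]) p"
proof
  assume *: "above h (s # p)"
  have "0 \<le> h + height [s] + height q" if "prefix q p" for q
    using *[unfolded above_def, rule_format, of "s # q"] that by (cases s) auto
  moreover have "0 \<le> h"
    using *[unfolded above_def, rule_format, of "[]"] by simp
  ultimately show "0 \<le> h \<and> above (h + height [s]) p"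
    by (auto simp: above_def)
next
  assume *: "0 \<le> h \<and> above (h + height [s]) p"
  show "above h (s # p)"
    unfolding above_def
  proof (intro allI impI)
    fix q assume "prefix q (s # p)"
    then show "0 \<le> h + height q"
      using * by (cases s) (auto simp: prefix_Cons above_def)
  qed
qed

lemma above_append: "above h (p @ q) \<longleftrightarrow> above h p \<and> above (h + height p) q"
proof (induction p arbitrary: h)
  case Nil
  then show ?case by (auto simp: above_def dest: spec[of _ "[]"])
next
  case (Cons s p)
  have "height (s # p) = height [s] + height p"
    by (cases s) auto
  then show ?case by (auto simp: above_Cons Cons.IH add.assoc)
qed

lemma above_mono: "above h p \<Longrightarrow> h \<le> h' \<Longrightarrow> above h' p"
  unfolding above_def by force

lemma above_replicate_U: "0 \<le> h \<Longrightarrow> above h (replicate k U)"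
  by (induction k arbitrary: h) (auto simp: above_Cons)

lemma end_point_diff: "\<exists>N. fst (end_point p) = height p + 2 * int N"
proof (induction p)
  case Nil
  then show ?case by (auto simp: end_point_def)
next
  case (Cons s p)
  then obtain N where "fst (end_point p) = height p + 2 * int N" by blast
  then show ?case
    by (cases s) (auto simp: end_point_def intro: exI[of _ N] exI[of _ "N + 1"])
qed

lemma UH_free_schroeder_iff:
  "UH_free_schroeder p \<longleftrightarrow> height p = 0 \<and> above 0 p \<and> UH_free p"
proof -
  obtain N where "fst (end_point p) = height p + 2 * int N"
    using end_point_diff by blast
  then show ?thesis
    by (cases "end_point p")
      (auto simp: UH_free_schroeder_def schroeder_paths_def above_def height_def)
qed

lemma UH_free_Nil: "UH_free []"
  by (simp add: UH_free_def)

lemma UH_free_Cons: "UH_free (s # p) \<longleftrightarrow> \<not> (s = U \<and> prefix [H] p) \<and> UH_free p"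
  by (auto simp: UH_free_def sublist_Cons_right)

lemma UH_free_not_U: "s \<noteq> U \<Longrightarrow> UH_free (s # p) \<longleftrightarrow> UH_free p"
  by (simp add: UH_free_Cons)

lemma UH_free_append_D: "UH_free (p @ D # q) \<longleftrightarrow> UH_free p \<and> UH_free q"
proof (induction p)
  case Nil
  then show ?case by (simp add: UH_free_Nil UH_free_not_U)
next
  case (Cons s p)
  have "prefix [H] (p @ D # q) \<longleftrightarrow> prefix [H] p"
    by (cases p) simp_all
  with Cons show ?case by (simp add: UH_free_Cons)
qed

lemma UH_free_replicate_U: "UH_free (replicate k U)"
  using set_mono_sublist[of "[U, H]" "replicate k U"] by (auto simp: UH_free_def)

lemma UH_free_sublist: "UH_free p \<Longrightarrow> sublist q p \<Longrightarrow> UH_free q"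
  using sublist_order.order_trans unfolding UH_free_def by blast

abbreviation first_return :: "nat \<Rightarrow> step list list \<Rightarrow> step list \<Rightarrow> step list" where
  "first_return k Ps Q \<equiv> replicate k U @ concat (map (\<lambda>P. D # P) Ps) @ D # Q"

lemma UH_free_schroeder_simps:
  "UH_free_schroeder []"
  "UH_free_schroeder (H # P) \<longleftrightarrow> UH_free_schroeder P"
  "UH_free_schroeder (U # D # P) \<longleftrightarrow> UH_free_schroeder P"
proof -
  have "UH_free (U # D # P) \<longleftrightarrow> UH_free P"
    using UH_free_append_D[of "[U]" P] UH_free_replicate_U[of 1] by simp
  then show "UH_free_schroeder (U # D # P) \<longleftrightarrow> UH_free_schroeder P"
    by (simp add: UH_free_schroeder_iff above_Cons)
qed (simp_all add: UH_free_schroeder_iff UH_free_Nil UH_free_not_U above_Cons)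

lemma descent_list:
  assumes "\<forall>P\<in>set Ps. UH_free_schroeder P" "UH_free_schroeder Q"
  shows "height (concat (map (\<lambda>P. D # P) Ps) @ D # Q) = - (int (length Ps) + 1)"
    and "above (int (length Ps) + 1) (concat (map (\<lambda>P. D # P) Ps) @ D # Q)"
    and "UH_free p \<Longrightarrow> UH_free (p @ concat (map (\<lambda>P. D # P) Ps) @ D # Q)"
proof -
  show "height (concat (map (\<lambda>P. D # P) Ps) @ D # Q) = - (int (length Ps) + 1)"
    using assms by (induction Ps) (auto simp: UH_free_schroeder_iff)
  show "above (int (length Ps) + 1) (concat (map (\<lambda>P. D # P) Ps) @ D # Q)"
    using assms
  proof (induction Ps)
    case Nil
    then show ?case by (auto simp: UH_free_schroeder_iff above_Cons)
  next
    case (Cons P Ps)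
    then have "above (1 + int (length Ps)) P"
      by (auto simp: UH_free_schroeder_iff intro: above_mono[of 0])
    with Cons show ?case
      by (auto simp: UH_free_schroeder_iff above_Cons above_append add_ac)
  qed
  show "UH_free (p @ concat (map (\<lambda>P. D # P) Ps) @ D # Q)" if "UH_free p"
    using assms that
    by (induction Ps arbitrary: p) (auto simp: UH_free_schroeder_iff UH_free_append_D)
qed

lemma UH_free_schroeder_first_return:
  assumes "\<forall>P\<in>set Ps. UH_free_schroeder P" "UH_free_schroeder Q"
  shows "UH_free_schroeder (first_return (length Ps + 1) Ps Q)"
  unfolding UH_free_schroeder_iff
proof (intro conjI)
  show "height (first_return (length Ps + 1) Ps Q) = 0"
    using descent_list(1)[OF assms] by (simp del: replicate_Suc)
  show "above 0 (first_return (length Ps + 1) Ps Q)"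
    using descent_list(2)[OF assms] above_replicate_U[of 0 "length Ps + 1"]
    unfolding above_append[of 0 "replicate (length Ps + 1) U"] height_replicate_U
    by (simp del: replicate_Suc add: add.commute)
  show "UH_free (first_return (length Ps + 1) Ps Q)"
    by (rule descent_list(3)[OF assms UH_free_replicate_U])
qed

lemma first_descent_unique:
  assumes "height P = 0" "above 0 P" "height P' = 0" "above 0 P'" "P @ D # R = P' @ D # R'"
  shows "P = P' \<and> R = R'"
proof -
  have *: False if "P' = P @ us" "us \<noteq> []" "us @ D # R' = D # R" "height P = 0" "above 0 P'"
    for P P' us R R'
    using that by (cases us) (auto simp: above_append above_Cons dest: above_nonneg)
  from assms(5) obtain us where "P = P' @ us \<and> us @ D # R = D # R' \<or> P @ us = P' \<and> D # R = us @ D # R'"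
    unfolding append_eq_append_conv2 by blast
  then show ?thesis
  proof (elim disjE conjE)
    assume "P = P' @ us" "us @ D # R = D # R'"
    with *[of P P' us R R'] assms(2,3) show ?thesis by (cases "us = []") auto
  next
    assume "P @ us = P'" "D # R = us @ D # R'"
    with *[of P' P us R' R] assms(1,4) show ?thesis by (cases "us = []") auto
  qed
qed

lemma descent_list_unique:
  assumes "length Ps = length Ps'"
    "\<forall>P\<in>set Ps. UH_free_schroeder P" "\<forall>P\<in>set Ps'. UH_free_schroeder P"
    "concat (map (\<lambda>P. D # P) Ps) @ D # Q = concat (map (\<lambda>P. D # P) Ps') @ D # Q'"
  shows "Ps = Ps' \<and> Q = Q'"
  using assms
proof (induction Ps Ps' rule: list_induct2)
  case Nil
  then show ?case by simp
next
  case (Cons P Ps P' Ps')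
  have "\<exists>R. concat (map (\<lambda>P. D # P) Ps) @ D # Q = D # R" for Ps :: "step list list" and Q
    by (cases Ps) auto
  then obtain R R' where
    R: "concat (map (\<lambda>P. D # P) Ps) @ D # Q = D # R"
      "concat (map (\<lambda>P. D # P) Ps') @ D # Q' = D # R'" by meson
  have "P = P' \<and> R = R'"
    by (rule first_descent_unique)
      (use Cons.prems R in \<open>auto simp: UH_free_schroeder_iff\<close>)
  then show ?case
    using Cons R by auto
qed

lemma replicate_U_unique:
  assumes "replicate k U @ D # R = replicate k' U @ D # R'"
  shows "k = k' \<and> R = R'"
  using assms
proof (induction k arbitrary: k')
  case 0
  then show ?case by (cases k') auto
next
  case (Suc k)
  then show ?case by (cases k') auto
qed

lemma first_return_unique:
  assumes "\<forall>P\<in>set Ps. UH_free_schroeder P" "\<forall>P\<in>set Ps'. UH_free_schroeder P"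
    "first_return (length Ps + 1) Ps Q = first_return (length Ps' + 1) Ps' Q'"
  shows "Ps = Ps' \<and> Q = Q'"
proof -
  have "\<exists>R. concat (map (\<lambda>P. D # P) Ps) @ D # Q = D # R" for Ps :: "step list list" and Q
    by (cases Ps) auto
  then obtain R R' where
    R: "concat (map (\<lambda>P. D # P) Ps) @ D # Q = D # R"
      "concat (map (\<lambda>P. D # P) Ps') @ D # Q' = D # R'" by meson
  then have "length Ps + 1 = length Ps' + 1 \<and> R = R'"
    by (intro replicate_U_unique) (use assms(3) in simp)
  then show ?thesis
    by (intro descent_list_unique) (use assms R in auto)
qed

lemma first_descent_exists:
  assumes "\<not> above 0 R"
  shows "\<exists>P S. R = P @ D # S \<and> height P = 0 \<and> above 0 P"
  using assms
proof (induction R rule: rev_induct)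
  case Nil
  then show ?case by simp
next
  case (snoc s R)
  show ?case
  proof (cases "above 0 R")
    case True
    then have "0 \<le> height R" by (simp add: above_def)
    with snoc.prems True have "s = D" "height R = 0"
      by (cases s; auto simp: above_append above_Cons)+
    with True show ?thesis by blast
  next
    case False
    with snoc.IH show ?thesis by fastforce
  qed
qed

lemma descent_list_exists:
  assumes "height R = - int j" "above (int j) R" "UH_free R"
  shows "\<exists>Ps Q. length Ps = j \<and> (\<forall>P\<in>set Ps. UH_free_schroeder P) \<and> UH_free_schroeder Q \<and>
    D # R = concat (map (\<lambda>P. D # P) Ps) @ D # Q"
  using assms
proof (induction j arbitrary: R)
  case 0
  then show ?case by (intro exI[of _ "[]"] exI[of _ R]) (auto simp: UH_free_schroeder_iff)
next
  case (Suc j)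
  then have "\<not> above 0 R" by (auto simp: above_def)
  from first_descent_exists[OF this] obtain P S where
    R: "R = P @ D # S" "height P = 0" "above 0 P" by blast
  have "UH_free P" "UH_free S" using Suc.prems(3) R(1) by (auto simp: UH_free_append_D)
  moreover have "above (int j) S" using Suc.prems(2) R by (auto simp: above_append above_Cons)
  ultimately obtain Ps Q where
    "length Ps = j" "\<forall>P\<in>set Ps. UH_free_schroeder P" "UH_free_schroeder Q"
    "D # S = concat (map (\<lambda>P. D # P) Ps) @ D # Q"
    using Suc.IH[of S] Suc.prems(1) R by auto
  with R \<open>UH_free P\<close> show ?case
    by (intro exI[of _ "P # Ps"] exI[of _ Q]) (auto simp: UH_free_schroeder_iff)
qed

lemma first_return_exists:
  assumes "UH_free_schroeder (U # P)"
  shows "\<exists>Ps Q. (\<forall>P\<in>set Ps. UH_free_schroeder P) \<and> UH_free_schroeder Q \<and>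
    U # P = first_return (length Ps + 1) Ps Q"
proof -
  define k where "k = length (takeWhile (\<lambda>s. s = U) P)"
  define R where "R = dropWhile (\<lambda>s. s = U) P"
  have "takeWhile (\<lambda>s. s = U) P = replicate k U"
    unfolding k_def by (induction P) auto
  then have "P = replicate k U @ R"
    using takeWhile_dropWhile_id[of "\<lambda>s. s = U" P] by (simp only: R_def)
  then have P: "U # P = replicate (k + 1) U @ R" by simp
  have hd: "R \<noteq> [] \<Longrightarrow> hd R \<noteq> U" using hd_dropWhile[of "\<lambda>s. s = U" P] by (simp add: R_def)
  have gp: "height (U # P) = 0" "above 0 (U # P)" "UH_free (U # P)"
    using assms unfolding UH_free_schroeder_iff by blast+
  have "\<exists>R'. R = D # R'"
  proof (cases R)
    case Nil
    with gp(1) show ?thesis unfolding P by simp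
  next
    case (Cons s R')
    have "s \<noteq> H"
    proof
      assume "s = H"
      moreover have "replicate (k + 1) U = replicate k U @ [U]"
        by (simp add: replicate_append_same)
      ultimately have "U # P = replicate k U @ [U, H] @ R'"
        unfolding P Cons by (simp only: append_assoc append.simps)
      then show False using gp(3) unfolding UH_free_def sublist_def by blast
    qed
    with Cons hd show ?thesis by (cases s) auto
  qed
  then obtain R' where R': "R = D # R'" by blast
  have "height R' = - int k" using gp(1) unfolding P R' by simp
  moreover have "above (int k) R'" using gp(2) unfolding P R' by (simp add: above_append above_Cons del: replicate_Suc)
  moreover have "UH_free R'" using gp(3) unfolding P R' by (simp only: UH_free_append_D)
  ultimately obtain Ps Q where
    *: "length Ps = k" "\<forall>P\<in>set Ps. UH_free_schroeder P" "UH_free_schroeder Q"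
      "D # R' = concat (map (\<lambda>P. D # P) Ps) @ D # Q"
    using descent_list_exists by blast
  then have "U # P = first_return (length Ps + 1) Ps Q"
    unfolding P R' by (simp only:)
  with * show ?thesis by blast
qed


section \<open>The map from UH-free Schroeder paths to paths without peaks at even level\<close>

text \<open>
  In the fourth equation, the path is
  \<open>U\<^sup>k D P\<^sub>1 D P\<^sub>2 \<dots> D P\<^sub>k\<close> with \<open>Ps = [P\<^sub>1, \<dots>, P\<^bsub>k-1\<^esub>]\<close> and \<open>Q = P\<^sub>k\<close>,
  so that \<open>k = length Ps + 1 \<ge> 2\<close>. The map is left unspecified outside the UH-free Schroeder paths.
\<close>
function psi :: "step list \<Rightarrow> step list" where
  "psi [] = []"
| "UH_free_schroeder P \<Longrightarrow> psi (H # P) = H # psi P"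
| "UH_free_schroeder P \<Longrightarrow> psi (U # D # P) = U # D # psi P"
| "Ps \<noteq> [] \<Longrightarrow> \<forall>P\<in>set Ps. UH_free_schroeder P \<Longrightarrow> UH_free_schroeder Q \<Longrightarrow>
    psi (replicate (length Ps + 1) U @ concat (map (\<lambda>P. D # P) Ps) @ D # Q) =
      U # concat (map (\<lambda>P. if P = [] then [H] else U # psi P @ [D]) Ps) @ D # psi Q"
| "\<not> UH_free_schroeder P \<Longrightarrow> psi P = undefined"
proof -
  show R if
    "x = [] \<Longrightarrow> R"
    "\<And>P. UH_free_schroeder P \<Longrightarrow> x = H # P \<Longrightarrow> R"
    "\<And>P. UH_free_schroeder P \<Longrightarrow> x = U # D # P \<Longrightarrow> R"
    "\<And>Ps Q. Ps \<noteq> [] \<Longrightarrow> \<forall>P\<in>set Ps. UH_free_schroeder P \<Longrightarrow> UH_free_schroeder Q \<Longrightarrow>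
       x = first_return (length Ps + 1) Ps Q \<Longrightarrow> R"
    "\<And>P. \<not> UH_free_schroeder P \<Longrightarrow> x = P \<Longrightarrow> R" for R x
  proof (cases "UH_free_schroeder x")
    case True
    show R
    proof (cases x)
      case Nil
      with that(1) show R .
    next
      case (Cons s P)
      show R
      proof (cases s)
        case U
        with True Cons first_return_exists obtain Ps Q where
          "\<forall>P\<in>set Ps. UH_free_schroeder P" "UH_free_schroeder Q"
          "x = first_return (length Ps + 1) Ps Q" by metis
        note * = this
        show R
        proof (cases "Ps = []")
          case True
          with * show R by (intro that(3)[of Q]) simp_all
        next
          case False
          from that(4)[OF this *] show R .
        qed
      next
        case D
        with True Cons show R
          using above_nonneg[of "-1" P] by (simp add: UH_free_schroeder_iff above_Cons)
      next
        case H
        with True Cons that(2)[of P] show R by (simp add: UH_free_schroeder_simps)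
      qed
    qed
  next
    case False
    then show R using that(5) by blast
  qed
next
  fix Ps Ps' :: "step list list" and Q Q'
  assume "\<forall>P\<in>set Ps. UH_free_schroeder P" "\<forall>P\<in>set Ps'. UH_free_schroeder P"
    "first_return (length Ps + 1) Ps Q = first_return (length Ps' + 1) Ps' Q'"
  from first_return_unique[OF this]
  show "U # concat (map (\<lambda>P. if P = [] then [H] else U # psi_sumC P @ [D]) Ps) @ D # psi_sumC Q =
    U # concat (map (\<lambda>P. if P = [] then [H] else U # psi_sumC P @ [D]) Ps') @ D # psi_sumC Q'"
    by simp
next
  fix Ps :: "step list list" and P Q
  assume "Ps \<noteq> []" "U # D # P = first_return (length Ps + 1) Ps Q"
  then have False by (cases Ps) auto
  then show "U # D # psi_sumC P =
    U # concat (map (\<lambda>P. if P = [] then [H] else U # psi_sumC P @ [D]) Ps) @ D # psi_sumC Q" ..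
next
  fix Ps :: "step list list" and P Q
  assume "\<forall>P\<in>set Ps. UH_free_schroeder P" "UH_free_schroeder Q" "\<not> UH_free_schroeder P"
    "first_return (length Ps + 1) Ps Q = P"
  with UH_free_schroeder_first_return have False by blast
  then show "U # concat (map (\<lambda>P. if P = [] then [H] else U # psi_sumC P @ [D]) Ps) @ D # psi_sumC Q =
    undefined" ..
next
  fix P P'
  assume "UH_free_schroeder P" "\<not> UH_free_schroeder P'" "H # P = P'"
  then have False using UH_free_schroeder_simps(2) by blast
  then show "H # psi_sumC P = undefined" ..
next
  fix P P'
  assume "UH_free_schroeder P" "\<not> UH_free_schroeder P'" "U # D # P = P'"
  then have False using UH_free_schroeder_simps(3) by blast
  then show "U # D # psi_sumC P = undefined" ..
qed (simp_all add: UH_free_schroeder_simps)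
termination
proof (relation "measure length")
  fix Ps :: "step list list" and P Q
  assume "P \<in> set Ps"
  then have "length P \<le> length (concat (map (\<lambda>P. D # P) Ps))"
    by (induction Ps) auto
  then show "(P, first_return (length Ps + 1) Ps Q) \<in> measure length"
    by (simp del: length_concat)
qed simp_all

end

theory Submission
  imports Defs "HOL-Library.Multiset"
begin

text \<open>
  A letter of a partition that is neither a left-to-right maximum nor equal to the current maximum
  is called small. A UH-free path prescribes which letters are maxima, equal to the maximum or
  small, and how often each letter occurs among the small ones; only the order of the small letters
  is left open. Avoiding 12321 means that the small letters are used as a queue (the smallest pending
  letter comes first), avoiding 12312 that they are used as a stack (the largest one comes first).
  In both cases the word is determined by the path.

  The map \<open>psi\<close> is inverted by decomposing a path at its first return to the axis: since no peak has
  even level, the part between the first up step and the first return is a concatenation of factors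
  \<open>H\<close> and \<open>U Z D\<close> with \<open>Z\<close> nonempty and again without peaks at even level.
\<close>

section \<open>Restricted growth words\<close>

text \<open>\<open>m\<close> is the maximum of the letters already read, so suffixes can be treated;
  canonical words have \<open>m = 0\<close>.\<close>

fun rgf :: "nat \<Rightarrow> nat list \<Rightarrow> bool" where
  "rgf m [] \<longleftrightarrow> True"
| "rgf m (a # w) \<longleftrightarrow> 1 \<le> a \<and> a \<le> Suc m \<and> rgf (max m a) w"

lemma rgf_iff:
  "rgf m w \<longleftrightarrow> 0 \<notin> set w \<and> (\<forall>i<length w. {m<..<w ! i} \<subseteq> set (take i w))"
proof (induction w arbitrary: m)
  case (Cons a w)
  have "{m<..<a} = {} \<longleftrightarrow> a \<le> Suc m" by (auto simp: set_eq_iff)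
  then have *: "(\<forall>i<length (a # w). {m<..<(a # w) ! i} \<subseteq> set (take i (a # w))) \<longleftrightarrow>
      a \<le> Suc m \<and> (\<forall>i<length w. {m<..<w ! i} \<subseteq> insert a (set (take i w)))"
    by (simp add: All_less_Suc2)
  have "{m<..<b} \<subseteq> insert a A \<longleftrightarrow> {max m a<..<b} \<subseteq> A" if "a \<le> Suc m" for b A
    using that by (auto simp: subset_iff)
  then show ?case
    unfolding rgf.simps Cons.IH * by (auto simp only: list.set Suc_le_eq One_nat_def insert_iff)
qed simp

text \<open>New maxima rise by one, so the values from \<open>Suc m\<close> to \<open>c - 1\<close>
  first occur in this order, before any letter \<open>c\<close>.\<close>

lemma rgf_subseq_upt:
  assumes "rgf m (p @ c # q)"
  shows "subseq [Suc m..<c] p"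
  using assms
proof (induction p arbitrary: m)
  case (Cons x p)
  then have IH: "subseq [Suc (max m x)..<c] p" and x: "x \<le> Suc m" by auto
  show ?case
  proof (cases "x = Suc m \<and> Suc m < c")
    case True
    with IH show ?thesis by (simp add: upt_conv_Cons max_def)
  next
    case False
    with IH x show ?thesis by (cases "x = Suc m") (auto simp: max_absorb1)
  qed
qed simp

text \<open>If \<open>b < w ! i\<close>, the block of \<open>b\<close> has the smaller minimum, so
  \<open>b\<close> occurs before position \<open>i\<close>.\<close>

lemma partition_word_rgf:
  assumes "w \<in> partition_words n"
  shows "rgf 0 w"
proof -
  from assms obtain Bs where Bs: "partition_on {1..n} (set Bs)"
    "sorted_wrt (\<lambda>A B. Min A < Min B) Bs" "length w = n" "set w \<subseteq> {1..length Bs}"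
    "\<And>i j. i < n \<Longrightarrow> j < length Bs \<Longrightarrow> w ! i = Suc j \<longleftrightarrow> Suc i \<in> Bs ! j"
    unfolding partition_words_def by blast
  have sub: "Bs ! j \<subseteq> {1..n}" "Bs ! j \<noteq> {}" if "j < length Bs" for j
    using Bs(1) that by (auto simp: partition_on_def dest: nth_mem)
  have fin: "finite (Bs ! j)" if "j < length Bs" for j
    using sub(1)[OF that] by (rule finite_subset) simp
  have "b \<in> set (take i w)" if i: "i < n" and b: "0 < b" "b < w ! i" for i b
  proof -
    have "w ! i \<in> set w" using i Bs(3) by simp
    then have wi: "w ! i \<le> length Bs" using Bs(4) by auto
    define j where "j = w ! i - 1"
    define l where "l = b - 1"
    have jl: "w ! i = Suc j" "b = Suc l" "l < j" "j < length Bs"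
      using b wi by (auto simp: j_def l_def)
    then have "Suc i \<in> Bs ! j" using Bs(5) i by blast
    then have "Min (Bs ! j) \<le> Suc i" using fin jl by simp
    moreover have "Min (Bs ! l) < Min (Bs ! j)"
      using Bs(2) jl by (simp add: sorted_wrt_iff_nth_less)
    moreover have mem: "Min (Bs ! l) \<in> Bs ! l"
      using jl fin sub by (intro Min_in) auto
    moreover have "1 \<le> Min (Bs ! l)" using mem sub(1)[of l] jl by auto
    \<comment> \<open>Elements count from 1, positions from 0.\<close>
    moreover define i' where "i' = Min (Bs ! l) - 1"
    ultimately have i': "i' < i" "Suc i' \<in> Bs ! l" by auto
    then have "w ! i' = b" using Bs(5)[of i' l] jl i by simp
    with i' i Bs(3) show ?thesis by (auto simp: in_set_conv_nth)
  qed
  with Bs(3,4) show ?thesis unfolding rgf_iff by auto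
qed

text \<open>The blocks are the level sets \<open>B j\<close>. Restricted growth makes every letter
  up to the maximum occur, so no block is empty, and puts smaller letters first, which orders the
  minima.\<close>

lemma rgf_partition_word:
  assumes "rgf 0 w"
  shows "w \<in> partition_words (length w)"
proof -
  define n where "n = length w"
  define B where "B j = {Suc i | i. i < n \<and> w ! i = Suc j}" for j
  \<comment> \<open>The inserted 0 covers the empty word, which has no blocks.\<close>
  define k where "k = Max (insert 0 (set w))"
  have w0: "0 \<notin> set w"
    using assms unfolding rgf_iff by blast
  have sub: "b \<in> set (take i w)" if "i < n" "0 < b" "b < w ! i" for i b
    using assms that unfolding rgf_iff n_def by (meson greaterThanLessThan_iff subsetD)
  have le: "a \<le> k" if "a \<in> set w" for a using that by (simp add: k_def)
  have in_w: "b \<in> set w" if "0 < b" "b \<le> k" for b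
  proof -
    have "k \<in> insert 0 (set w)" unfolding k_def by (rule Max_in) simp_all
    then have "k \<in> set w" using that by auto
    then obtain i where "i < n" "w ! i = k"
      by (auto simp: in_set_conv_nth n_def)
    with that sub[of i b] show ?thesis
      by (cases "b = k") (auto simp: n_def dest: in_set_takeD)
  qed
  have fin: "finite (B j)" for j by (simp add: B_def)
  have ne: "B j \<noteq> {}" if "j < k" for j
    using in_w[of "Suc j"] that by (auto simp: B_def in_set_conv_nth n_def)
  have less: "Min (B j) < Min (B j')" if "j < j'" "j' < k" for j j'
  proof -
    have "Min (B j') \<in> B j'" using fin ne that by (intro Min_in) auto
    then obtain i where i: "Min (B j') = Suc i" "i < n" "w ! i = Suc j'"
      by (auto simp: B_def)
    then have "Suc j \<in> set (take i w)" using sub[of i "Suc j"] that by simp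
    then obtain i' where "i' < i" "w ! i' = Suc j"
      by (auto simp: in_set_conv_nth)
    then have "Suc i' \<in> B j" using i by (auto simp: B_def)
    then have "Min (B j) \<le> Suc i'" using fin by simp
    with \<open>i' < i\<close> i show ?thesis by simp
  qed
  have letter: "\<exists>j<k. w ! i = Suc j" if "i < n" for i
  proof -
    have "w ! i \<in> set w" using that by (simp add: n_def)
    then have "w ! i \<le> k" "w ! i \<noteq> 0" using le w0 by metis+
    then show ?thesis by (cases "w ! i") auto
  qed
  have "partition_on {1..n} (B ` {..<k})"
  proof (rule partition_onI)
    show "\<Union> (B ` {..<k}) = {1..n}"
    proof (intro equalityI subsetI)
      fix x assume x: "x \<in> {1..n}"
      then have "x - 1 < n" by auto
      then obtain j where "j < k" "w ! (x - 1) = Suc j" using letter by blast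
      with x have "x \<in> B j" by (auto simp: B_def intro!: exI[of _ "x - 1"])
      with \<open>j < k\<close> show "x \<in> \<Union> (B ` {..<k})" by blast
    qed (auto simp: B_def)
    show "disjnt p q" if "p \<in> B ` {..<k}" "q \<in> B ` {..<k}" "p \<noteq> q" for p q
      using that by (auto simp: disjnt_def B_def)
    show "{} \<notin> B ` {..<k}" using ne by force
  qed
  then have "partition_on {1..n} (set (map B [0..<k]))"
    by (simp add: atLeast0LessThan)
  moreover have "sorted_wrt (\<lambda>A B. Min A < Min B) (map B [0..<k])"
    using less by (simp add: sorted_wrt_iff_nth_less)
  moreover have "set w \<subseteq> {1..k}" using w0 le by (auto simp: Suc_le_eq intro: gr0I)
  moreover have "\<forall>i<n. \<forall>j<k. w ! i = Suc j \<longleftrightarrow> Suc i \<in> map B [0..<k] ! j"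
    by (auto simp: B_def)
  ultimately show ?thesis
    unfolding partition_words_def n_def[symmetric]
    by (intro CollectI exI[of _ "map B [0..<k]"]) (simp add: n_def)
qed

lemma partition_words_eq: "partition_words n = {w. length w = n \<and> rgf 0 w}"
  using partition_word_rgf rgf_partition_word by (auto simp: partition_words_def)

text \<open>The initial letter 1 is forced and contributes no step; it is split off.\<close>

lemma partition_words_Suc:
  "partition_words (Suc n) = (#) 1 ` {w. length w = n \<and> rgf 1 w}"
proof -
  have "length v = Suc n \<and> rgf 0 v \<longleftrightarrow> (\<exists>w. v = 1 # w \<and> length w = n \<and> rgf 1 w)" for v
    by (cases v) (auto simp: le_Suc_eq)
  then show ?thesis by (auto simp: partition_words_eq image_iff)
qed


section \<open>Avoidance in restricted growth words\<close>

text \<open>The letter \<open>c\<close> certifies that \<open>a\<close> is small and that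
  \<open>b\<close> is pending when \<open>a\<close> is read. It need not be the maximum, so this is
  a condition on subsequences.\<close>

definition small_letters_sorted :: "(nat \<Rightarrow> nat \<Rightarrow> bool) \<Rightarrow> nat list \<Rightarrow> bool" where
  "small_letters_sorted le w \<longleftrightarrow> (\<forall>c a b. subseq [c, a, b] w \<longrightarrow> a < c \<longrightarrow> b < c \<longrightarrow> le a b)"

lemma subseq_Cons_iff:
  "subseq (x # xs) (y # ys) \<longleftrightarrow> x = y \<and> subseq xs ys \<or> subseq (x # xs) ys"
  by (auto simp: subseq_Cons2_iff dest: subseq_Cons')

lemma subseq_singleton_left_iff: "subseq [x] w \<longleftrightarrow> x \<in> set w"
  by (induction w) (auto simp: subseq_Cons_iff)

text \<open>Of two front letters only the larger is needed as \<open>c\<close>; the first conjunct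
  covers the triples in which \<open>x\<close> is the middle entry.\<close>

lemma small_letters_sorted_Cons2:
  "small_letters_sorted le (m # x # w) \<longleftrightarrow>
     (x < m \<longrightarrow> (\<forall>b\<in>set w. b < m \<longrightarrow> le x b)) \<and> small_letters_sorted le (max m x # w)"
  (is "?L \<longleftrightarrow> ?R")
proof
  assume ?L
  then show ?R
    unfolding small_letters_sorted_def subseq_Cons_iff subseq_singleton_left_iff
    by (auto simp: max_def split: if_splits)
next
  assume R: ?R
  then have 1: "x < m \<Longrightarrow> b \<in> set w \<Longrightarrow> b < m \<Longrightarrow> le x b"
    and 2: "subseq [a, b] w \<Longrightarrow> a < max m x \<Longrightarrow> b < max m x \<Longrightarrow> le a b"
    and 3: "subseq [c, a, b] w \<Longrightarrow> a < c \<Longrightarrow> b < c \<Longrightarrow> le a b" for a b c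
    unfolding small_letters_sorted_def subseq_Cons_iff by blast+
  show ?L
    unfolding small_letters_sorted_def subseq_Cons_iff subseq_singleton_left_iff
    using 1 2 3 by (auto simp: less_max_iff_disj)
qed

lemma subseq_Cons_split:
  assumes "subseq (c # u) w"
  shows "\<exists>p q. w = p @ c # q \<and> subseq u q"
  using assms
  by (auto dest!: list_emb_ConsD)

text \<open>The front letters \<open>a < b\<close> of either pattern come for free, since 1 to
  \<open>c - 1\<close> occur in increasing order before \<open>c\<close>. Only the pattern from its
  largest letter on has to be tested.\<close>

lemma rgf_subseq_below:
  assumes "rgf 0 w" "subseq (c # u) w" "0 < a" "a < b" "b < c"
  shows "subseq (a # b # c # u) w"
proof -
  obtain p q where w: "w = p @ c # q" "subseq u q"
    using subseq_Cons_split[OF assms(2)] by blast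
  have "subseq ([a] @ [b]) ([1..<b] @ [b..<c])"
    using assms(3-5) by (intro list_emb_append_mono) (auto simp: subseq_singleton_left_iff)
  moreover have "[1..<b] @ [b..<c] = [1..<c]"
    using assms(3-5) upt_add_eq_append[of 1 b "c - b"] by simp
  ultimately have "subseq [a, b] [1..<c]" by simp
  then have "subseq [a, b] p"
    using rgf_subseq_upt[of 0 p c q] assms(1) w(1) by (auto intro: subseq_order.trans)
  moreover have "subseq (c # u) (c # q)" using w(2) by simp
  ultimately have "subseq ([a, b] @ (c # u)) (p @ (c # q))" by (rule list_emb_append_mono)
  with w(1) show ?thesis by simp
qed

section \<open>The patterns 12321 and 12312 in terms of small letters\<close>

lemma order_isomorphic_12321:
  "order_isomorphic u [1, 2, 3, 2, 1] \<longleftrightarrow> (\<exists>a b c. u = [a, b, c, b, a] \<and> a < b \<and> b < c)"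
proof
  show "order_isomorphic u [1, 2, 3, 2, 1] \<Longrightarrow> \<exists>a b c. u = [a, b, c, b, a] \<and> a < b \<and> b < c"
    by (auto simp: order_isomorphic_def length_Suc_conv eval_nat_numeral All_less_Suc)
qed (auto simp: order_isomorphic_def less_Suc_eq)

lemma order_isomorphic_12312:
  "order_isomorphic u [1, 2, 3, 1, 2] \<longleftrightarrow> (\<exists>a b c. u = [a, b, c, a, b] \<and> a < b \<and> b < c)"
proof
  show "order_isomorphic u [1, 2, 3, 1, 2] \<Longrightarrow> \<exists>a b c. u = [a, b, c, a, b] \<and> a < b \<and> b < c"
    by (auto simp: order_isomorphic_def length_Suc_conv eval_nat_numeral All_less_Suc)
qed (auto simp: order_isomorphic_def less_Suc_eq)

lemma rgf_subseq_pos: "rgf 0 w \<Longrightarrow> subseq u w \<Longrightarrow> a \<in> set u \<Longrightarrow> 0 < a"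
  using rgf_iff[of 0 w] by (auto dest: list_emb_set intro: gr0I)

text \<open>By \<open>rgf_subseq_below\<close> the pattern occurs exactly if its tail 321 does, a
  descending pair of letters below an earlier one.\<close>

lemma avoids_12321:
  assumes "rgf 0 w"
  shows "avoids w [1, 2, 3, 2, 1] \<longleftrightarrow> small_letters_sorted (\<le>) w"
proof -
  have "subseq [a, b, c, b, a] w \<longleftrightarrow> subseq [c, b, a] w" if "a < b" "b < c" for a b c
    using that rgf_subseq_below[OF assms, of c "[b, a]" a b] rgf_subseq_pos[OF assms, of "[c, b, a]" a]
    by (auto dest: subseq_Cons')
  then have "avoids w [1, 2, 3, 2, 1] \<longleftrightarrow> (\<forall>a b c. a < b \<longrightarrow> b < c \<longrightarrow> \<not> subseq [c, b, a] w)"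
    unfolding avoids_def order_isomorphic_12321 by blast
  also have "\<dots> \<longleftrightarrow> small_letters_sorted (\<le>) w"
    unfolding small_letters_sorted_def by (meson not_le order.strict_trans)
  finally show ?thesis .
qed

text \<open>Here the tail is 312, an ascending pair below an earlier letter.\<close>

lemma avoids_12312:
  assumes "rgf 0 w"
  shows "avoids w [1, 2, 3, 1, 2] \<longleftrightarrow> small_letters_sorted (\<ge>) w"
proof -
  have "subseq [a, b, c, a, b] w \<longleftrightarrow> subseq [c, a, b] w" if "a < b" "b < c" for a b c
    using that rgf_subseq_below[OF assms, of c "[a, b]" a b] rgf_subseq_pos[OF assms, of "[c, a, b]" a]
    by (auto dest: subseq_Cons')
  then have "avoids w [1, 2, 3, 1, 2] \<longleftrightarrow> (\<forall>a b c. a < b \<longrightarrow> b < c \<longrightarrow> \<not> subseq [c, a, b] w)"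
    unfolding avoids_def order_isomorphic_12312 by blast
  also have "\<dots> \<longleftrightarrow> small_letters_sorted (\<ge>) w"
    unfolding small_letters_sorted_def by (meson not_le order.strict_trans)
  finally show ?thesis .
qed


section \<open>Encoding words by paths\<close>

text \<open>A recursive form of \<open>word_path\<close> with current maximum \<open>m\<close>. At a
  new maximum \<open>a\<close> the unread suffix is all that follows the first \<open>a\<close>, so
  the count is the required number of later copies of \<open>a - 1\<close>.\<close>

fun enc :: "nat \<Rightarrow> nat list \<Rightarrow> step list" where
  "enc m [] = []"
| "enc m (a # w) =
     (if m < a then replicate (count_list w (a - 1) + 1) U @ D # enc a w
      else if a < m then D # enc m w
      else H # enc m w)"

lemma dropWhile_neq_append: "a \<notin> set v \<Longrightarrow> dropWhile (\<lambda>x. x \<noteq> a) (v @ a # u) = a # u"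
  by (induction v) auto

text \<open>The read part \<open>v\<close> matters only through its maximum: a larger letter does
  not occur in \<open>v\<close>, so \<open>dropWhile\<close> stops exactly at it.\<close>

lemma word_path_suffix:
  assumes "v \<noteq> []"
  shows "concat (map (letter_steps (v @ u)) [length v..<length (v @ u)]) = enc (Max (set v)) u"
  using assms
proof (induction u arbitrary: v)
  case (Cons a u)
  define m where "m = Max (set v)"
  have IH: "concat (map (letter_steps (v @ a # u)) [Suc (length v)..<length (v @ a # u)]) = enc (max m a) u"
    using Cons.IH[of "v @ [a]"] Cons.prems by (simp add: m_def max.commute)
  have "a \<notin> set v" if "m < a" using that Max_ge[of "set v" a] by (auto simp: m_def simp del: Max_ge)
  then have "later_occurrences (v @ a # u) (a - 1) = count_list u (a - 1)" if "m < a"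
    using that by (simp add: later_occurrences_def dropWhile_neq_append)
  then have "letter_steps (v @ a # u) (length v) =
      (if m < a then replicate (count_list u (a - 1) + 1) U @ [D] else if a < m then [D] else [H])"
    using Cons.prems by (auto simp: letter_steps_def Let_def m_def)
  moreover have "[length v..<length (v @ a # u)] = length v # [Suc (length v)..<length (v @ a # u)]"
    by (rule upt_conv_Cons) simp
  ultimately show ?case
    using IH by (simp add: m_def[symmetric] max_def)
qed simp

lemma word_path_Cons: "word_path (a # w) = enc a w"
  using word_path_suffix[of "[a]" w]
  by (simp add: word_path_def upt_conv_Cons letter_steps_def del: upt_Suc)

text \<open>Each of these unread letters will be small and give a down step; their number is the
  current height of the path.\<close>

abbreviation pending :: "nat \<Rightarrow> nat list \<Rightarrow> nat multiset" where
  "pending m w \<equiv> filter_mset (\<lambda>a. a < m) (mset w)"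

text \<open>When the maximum passes \<open>m\<close>, the unread copies of \<open>m\<close> become
  pending; they account for the surplus up steps.\<close>

lemma pending_Suc: "pending (Suc m) w = pending m w + replicate_mset (count_list w m) m"
  by (induction w) (auto simp: less_Suc_eq)

section \<open>End point, height and UH-freeness of an encoded word\<close>

lemma end_point_append: "end_point (p @ q) = end_point p + end_point q"
  by (simp add: end_point_def)

lemma end_point_Cons: "end_point (s # p) = step_vector s + end_point p"
  by (simp add: end_point_def)

lemma end_point_Nil: "end_point [] = 0"
  by (simp add: end_point_def)

lemma end_point_replicate_U: "end_point (replicate k U) = (int k, int k)"
  by (induction k) (simp_all add: end_point_Nil end_point_Cons zero_prod_def)

text \<open>The steps of a letter change the height by the change in the number of pending letters,
  and their width is 2 plus this change.\<close>

lemma end_point_enc: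
  assumes "rgf m w"
  shows "end_point (enc m w) =
    (2 * int (length w) - int (size (pending m w)), - int (size (pending m w)))"
  using assms
proof (induction w arbitrary: m)
  case (Cons a w)
  consider "a = Suc m" | "a < m" | "a = m" using Cons.prems by force
  then show ?case
    using Cons
    by cases (simp_all add: end_point_append end_point_Cons end_point_replicate_U pending_Suc
        max_def del: replicate_Suc)
qed (simp add: end_point_Nil zero_prod_def)

lemma above_enc: "rgf m w \<Longrightarrow> above (int (size (pending m w))) (enc m w)"
proof (induction w arbitrary: m)
  case (Cons a w)
  consider "a = Suc m" | "a < m" | "a = m" using Cons.prems by force
  then show ?case
  proof cases
    case 1
    have "above (int (size (pending (Suc m) w))) (enc (Suc m) w)"
      using Cons 1 by (simp add: max_def)
    with 1 show ?thesis
      by (simp add: above_append above_Cons above_replicate_U pending_Suc add_ac del: replicate_Suc)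
  qed (use Cons in \<open>auto simp: above_Cons max_def\<close>)
qed simp

lemma UH_free_enc: "UH_free (enc m w)"
  by (induction w arbitrary: m)
    (auto simp: UH_free_Nil UH_free_not_U UH_free_append_D UH_free_replicate_U simp del: replicate_Suc)

text \<open>The negative height of \<open>p\<close> forces a step other than \<open>U\<close>; by
  UH-freeness the first such step is \<open>D\<close>.\<close>

lemma UH_free_leading_U:
  assumes "UH_free (U # p)" "height p < 0"
  shows "\<exists>k q. U # p = replicate (Suc k) U @ D # q"
proof -
  have "\<exists>s\<in>set p. s \<noteq> U" using assms(2)
  proof (rule contrapos_pp)
    assume "\<not> (\<exists>s\<in>set p. s \<noteq> U)"
    then have "p = replicate (length p) U" by (simp add: replicate_length_same)
    then have "height p = int (length p)" by (metis height_replicate_U)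
    then show "\<not> height p < 0" by simp
  qed
  with assms(1) show ?thesis
  proof (induction p)
    case (Cons s p)
    show ?case
    proof (cases s)
      case U
      with Cons obtain k q where "U # p = replicate (Suc k) U @ D # q"
        by (auto simp: UH_free_Cons)
      with U show ?thesis by (intro exI[of _ "Suc k"] exI[of _ q]) simp
    next
      case D
      then show ?thesis by (intro exI[of _ 0] exI[of _ p]) simp
    qed (use Cons.prems in \<open>simp add: UH_free_Cons\<close>)
  qed simp
qed

text \<open>This decodes from the left. Under restricted growth only a leading \<open>D\<close>
  leaves the value of the letter open.\<close>

lemma enc_eq_simps:
  "enc m w = [] \<longleftrightarrow> w = []"
  "enc m w = H # p \<longleftrightarrow> (\<exists>w'. w = m # w' \<and> enc m w' = p)"
  "enc m w = D # p \<longleftrightarrow> (\<exists>a w'. w = a # w' \<and> a < m \<and> enc m w' = p)"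
  "enc m w = replicate (Suc k) U @ D # p \<longleftrightarrow>
     (\<exists>a w'. w = a # w' \<and> m < a \<and> count_list w' (a - 1) = k \<and> enc a w' = p)"
proof -
  show "enc m w = replicate (Suc k) U @ D # p \<longleftrightarrow>
     (\<exists>a w'. w = a # w' \<and> m < a \<and> count_list w' (a - 1) = k \<and> enc a w' = p)"
    by (cases w) (auto dest: replicate_U_unique)
qed (cases w; force)+

text \<open>Of two pending letters with \<open>le a b\<close>, the letter \<open>a\<close> is used first.\<close>
locale priority =
  fixes le :: "nat \<Rightarrow> nat \<Rightarrow> bool"
  assumes antisym: "le a b \<Longrightarrow> le b a \<Longrightarrow> a = b"
    and least: "finite A \<Longrightarrow> A \<noteq> {} \<Longrightarrow> \<exists>a\<in>A. \<forall>b\<in>A. le a b"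
begin

text \<open>The triple \<open>m\<close>, \<open>M\<close>, \<open>p\<close> is a decoding state and
  \<open>w\<close> an admissible continuation. The \<open>m\<close> in front of \<open>w\<close>
  stands for all letters read before.\<close>

definition codes :: "nat \<Rightarrow> nat multiset \<Rightarrow> step list \<Rightarrow> nat list \<Rightarrow> bool" where
  "codes m M p w \<longleftrightarrow>
     rgf m w \<and> small_letters_sorted le (m # w) \<and> pending m w = M \<and> enc m w = p"

lemma codes_Nil: "codes m M [] w \<longleftrightarrow> w = [] \<and> M = {#}"
  by (auto simp: codes_def enc_eq_simps small_letters_sorted_def subseq_Cons_iff)

lemma codes_H: "1 \<le> m \<Longrightarrow> codes m M (H # p) w \<longleftrightarrow> (\<exists>w'. w = m # w' \<and> codes m M p w')"
  by (auto simp: codes_def enc_eq_simps small_letters_sorted_Cons2)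

text \<open>The later letters below \<open>m\<close> are the remaining pending ones, so sortedness
  forces \<open>a\<close> to be \<open>le\<close>-least in \<open>M\<close>.\<close>

lemma codes_D:
  "codes m M (D # p) w \<longleftrightarrow>
    (\<exists>a w'. w = a # w' \<and> 1 \<le> a \<and> a < m \<and> a \<in># M \<and> (\<forall>b\<in>#M - {#a#}. le a b) \<and>
      codes m (M - {#a#}) p w')"
proof -
  have "(\<forall>b\<in>set w'. b < m \<longrightarrow> le a b) \<longleftrightarrow> (\<forall>b\<in>#pending m w'. le a b)" for a w'
    by auto
  moreover have "add_mset a N = M \<longleftrightarrow> a \<in># M \<and> N = M - {#a#}" for a N
    by auto
  ultimately show ?thesis
    by (auto simp: codes_def enc_eq_simps small_letters_sorted_Cons2 max_def simp del: set_mset_filter)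
qed

text \<open>As \<open>M\<close> contains no \<open>m\<close>, the enlarged multiset splits uniquely
  into \<open>M\<close> and copies of \<open>m\<close>; the new state therefore remembers
  \<open>k\<close>.\<close>

lemma codes_U:
  assumes "set_mset M \<subseteq> {..<m}"
  shows "codes m M (replicate (Suc k) U @ D # p) w \<longleftrightarrow>
    (\<exists>w'. w = Suc m # w' \<and> codes (Suc m) (M + replicate_mset k m) p w')"
proof -
  have "pending m w' = M \<and> count_list w' m = k \<longleftrightarrow> pending (Suc m) w' = M + replicate_mset k m" for w'
  proof
    assume *: "pending (Suc m) w' = M + replicate_mset k m"
    have "count (pending m w') m = 0" "count M m = 0"
      using assms by (auto simp: count_eq_zero_iff)
    with arg_cong[OF *, of "\<lambda>A. count A m"] have "count_list w' m = k"
      by (simp add: pending_Suc)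
    with * show "pending m w' = M \<and> count_list w' m = k" by (simp add: pending_Suc)
  qed (simp add: pending_Suc)
  note pending = this
  have max: "max m (Suc m) = Suc m" by simp
  show ?thesis
  proof
    assume L: "codes m M (replicate (Suc k) U @ D # p) w"
    then obtain a w' where w: "w = a # w'" "m < a" "count_list w' (a - 1) = k" "enc a w' = p"
      by (auto simp only: codes_def enc_eq_simps)
    with L have "a = Suc m" by (auto simp: codes_def)
    with L w pending[of w'] show "\<exists>w'. w = Suc m # w' \<and> codes (Suc m) (M + replicate_mset k m) p w'"
      by (simp add: codes_def small_letters_sorted_Cons2 max)
  next
    assume "\<exists>w'. w = Suc m # w' \<and> codes (Suc m) (M + replicate_mset k m) p w'"
    then obtain w' where "w = Suc m # w'" "codes (Suc m) (M + replicate_mset k m) p w'" by blast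
    with pending[of w'] show "codes m M (replicate (Suc k) U @ D # p) w"
      by (simp add: codes_def small_letters_sorted_Cons2 max)
  qed
qed

text \<open>Decoding is deterministic: each \<open>H\<close>, each \<open>D\<close> and each run of
  up steps with its \<open>D\<close> fixes one letter and the next state. The start height is the
  number of pending letters.\<close>

lemma ex1_codes:
  assumes "height p = - int (size M)" "above (int (size M)) p" "UH_free p"
    "set_mset M \<subseteq> {1..<m}" "1 \<le> m"
  shows "\<exists>!w. codes m M p w"
  using assms
proof (induction "length p" arbitrary: p m M rule: less_induct)
  case less
  show ?case
  proof (cases p)
    case Nil
    with less.prems(1) show ?thesis by (auto simp: codes_Nil)
  next
    case (Cons s p')
    show ?thesis
    proof (cases s)
      case H
      have "\<exists>!w. codes m M p' w"
        by (rule less.hyps) (use less.prems Cons H in \<open>auto simp: above_Cons UH_free_Cons\<close>)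
      then show ?thesis unfolding Cons H codes_H[OF less.prems(5)] by blast
    next
      case D
      \<comment> \<open>A down step starts at height at least 1, so some letter is pending.\<close>
      have "0 \<le> int (size M) - 1"
        using less.prems(2) Cons D by (auto simp: above_Cons dest: above_nonneg)
      then have "M \<noteq> {#}" by auto
      then obtain a where a: "a \<in># M" "\<forall>b\<in>#M. le a b"
        using least[of "set_mset M"] by auto
      have size: "int (size (M - {#a#})) = int (size M) - 1"
        using a(1) \<open>0 \<le> int (size M) - 1\<close> by (simp add: size_Diff_singleton of_nat_diff)
      have "\<exists>!w. codes m (M - {#a#}) p' w"
        by (rule less.hyps)
          (use less.prems Cons D size in \<open>auto simp: above_Cons UH_free_Cons dest: in_diffD\<close>)
      then obtain w0 where w0: "codes m (M - {#a#}) p' w0"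
        "\<And>w. codes m (M - {#a#}) p' w \<Longrightarrow> w = w0" by blast
      \<comment> \<open>A second candidate would be related to \<open>a\<close> by \<open>le\<close>
        in both directions.\<close>
      have unique: "a' = a" if "a' \<in># M" "\<forall>b\<in>#M - {#a'#}. le a' b" for a'
      proof (rule ccontr)
        assume "a' \<noteq> a"
        then have "a \<in># M - {#a'#}"
          using a(1) that(1) by (metis insert_noteq_member insert_DiffM)
        with that a(2) antisym \<open>a' \<noteq> a\<close> show False by blast
      qed
      show ?thesis
        unfolding Cons D
      proof (rule ex1I[of _ "a # w0"])
        have "1 \<le> a" "a < m" using a(1) less.prems(4) by auto
        then show "codes m M (D # p') (a # w0)"
          using a w0(1) by (auto simp: codes_D dest: in_diffD)
      next
        fix w assume "codes m M (D # p') w"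
        then show "w = a # w0" using unique w0(2) unfolding codes_D by blast
      qed
    next
      case U
      \<comment> \<open>The whole run is removed, since it encodes a single new maximum.\<close>
      obtain k q where q: "p = replicate (Suc k) U @ D # q"
        using UH_free_leading_U[of p'] less.prems(1,3) Cons U by auto
      let ?M = "M + replicate_mset k m"
      have "\<exists>!w. codes (Suc m) ?M q w"
      proof (rule less.hyps)
        show "length q < length p" using q by simp
        show "height q = - int (size ?M)" using less.prems(1) unfolding q by simp
        show "above (int (size ?M)) q"
          using less.prems(2) unfolding q by (auto simp: above_append above_Cons add_ac)
        show "UH_free q" using less.prems(3) unfolding q by (simp only: UH_free_append_D)
        show "set_mset ?M \<subseteq> {1..<Suc m}" using less.prems(4,5) by (auto split: if_splits)
      qed simp
      moreover have "set_mset M \<subseteq> {..<m}" using less.prems(4) by auto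
      ultimately show ?thesis unfolding q codes_U[OF \<open>set_mset M \<subseteq> {..<m}\<close>] by blast
    qed
  qed
qed

lemma codes_initial:
  "codes 1 {#} p w \<longleftrightarrow> rgf 1 w \<and> small_letters_sorted le (1 # w) \<and> enc 1 w = p"
proof -
  have "pending 1 w = {#}" if "rgf 1 w"
    using that by (auto simp: rgf_iff intro: gr0I)
  then show ?thesis by (auto simp: codes_def)
qed

text \<open>Both injectivity and surjectivity are \<open>ex1_codes\<close> for the state after the
  initial 1; the end point matches semilength with word length.\<close>

lemma bij_betw_word_path:
  "bij_betw word_path {v \<in> partition_words (Suc n). small_letters_sorted le v}
     {p \<in> schroeder_paths n. UH_free p}"
    (is "bij_betw _ ?A ?B")
proof (rule bij_betwI')
  have A: "v \<in> ?A \<longleftrightarrow> (\<exists>w. v = 1 # w \<and> length w = n \<and> codes 1 {#} (enc 1 w) w)" for v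
    unfolding partition_words_Suc codes_initial by auto
  have end_point: "end_point p = (2 * int (length w), 0)" "above 0 p" "UH_free p"
    if "codes 1 {#} p w" for p w
  proof -
    have w: "rgf 1 w" "pending 1 w = {#}" "enc 1 w = p" using that by (simp_all only: codes_def)
    show "end_point p = (2 * int (length w), 0)" "above 0 p" "UH_free p"
      using end_point_enc[OF w(1)] above_enc[OF w(1)] UH_free_enc[of 1 w] unfolding w(2,3) by simp_all
  qed
  have B: "p \<in> ?B \<longleftrightarrow> end_point p = (2 * int n, 0) \<and> above 0 p \<and> UH_free p" for p
    by (auto simp: schroeder_paths_def above_def)
  have ex1: "\<exists>!w. codes 1 {#} p w" if "p \<in> ?B" for p
    using that unfolding B by (intro ex1_codes) (auto simp: height_def)
  show B_image: "word_path v \<in> ?B" if "v \<in> ?A" for v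
    using that end_point unfolding A B by (auto simp: word_path_Cons)
  show "word_path v = word_path v' \<longleftrightarrow> v = v'" if "v \<in> ?A" "v' \<in> ?A" for v v'
  proof
    assume eq: "word_path v = word_path v'"
    from that obtain w w' where w: "v = 1 # w" "codes 1 {#} (enc 1 w) w"
      "v' = 1 # w'" "codes 1 {#} (enc 1 w') w'" unfolding A by blast
    with eq have "codes 1 {#} (word_path v) w" "codes 1 {#} (word_path v) w'"
      by (simp_all only: word_path_Cons)
    with ex1[OF B_image[OF that(1)]] w show "v = v'" by blast
  qed simp
  show "\<exists>v\<in>?A. p = word_path v" if p: "p \<in> ?B" for p
  proof -
    obtain w where w: "codes 1 {#} p w" using ex1[OF p] by blast
    moreover have "length w = n" using end_point(1)[OF w] p unfolding B by simp
    moreover have "enc 1 w = p" using w by (simp add: codes_def)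
    ultimately have "1 # w \<in> ?A" "p = word_path (1 # w)"
      unfolding A by (auto simp: word_path_Cons)
    then show ?thesis by blast
  qed
qed

end

interpretation queue: priority "(\<le>)"
proof
  show "\<exists>a\<in>A. \<forall>b\<in>A. a \<le> b" if "finite A" "A \<noteq> {}" for A :: "nat set"
    using that by (intro bexI[of _ "Min A"]) auto
qed simp

interpretation stack: priority "(\<ge>)"
proof
  show "\<exists>a\<in>A. \<forall>b\<in>A. a \<ge> b" if "finite A" "A \<noteq> {}" for A :: "nat set"
    using that by (intro bexI[of _ "Max A"]) auto
qed simp

lemma bij_betw_sigma:
  "bij_betw (sigma n) (avoiding_partitions (n + 1) [1, 2, 3, 1, 2]) {p \<in> schroeder_paths n. UH_free p}"
proof -
  have "avoiding_partitions (n + 1) [1, 2, 3, 1, 2] =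
      {v \<in> partition_words (Suc n). small_letters_sorted (\<ge>) v}"
    using avoids_12312 by (auto simp: avoiding_partitions_def partition_words_eq)
  with stack.bij_betw_word_path[of n] show ?thesis
    unfolding sigma_def by (simp only: bij_betw_restrict_eq)
qed

lemma bij_betw_phi:
  "bij_betw (phi n) (avoiding_partitions (n + 1) [1, 2, 3, 2, 1]) {p \<in> schroeder_paths n. UH_free p}"
proof -
  have "avoiding_partitions (n + 1) [1, 2, 3, 2, 1] =
      {v \<in> partition_words (Suc n). small_letters_sorted (\<le>) v}"
    using avoids_12321 by (auto simp: avoiding_partitions_def partition_words_eq)
  with queue.bij_betw_word_path[of n] show ?thesis
    unfolding phi_def by (simp only: bij_betw_restrict_eq)
qed


section \<open>Balanced paths and the parity of peaks\<close>

text \<open>Schroeder paths with the semilength forgotten; arguments and values of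
  \<open>psi\<close> are both of this kind.\<close>

definition balanced :: "step list \<Rightarrow> bool" where
  "balanced p \<longleftrightarrow> height p = 0 \<and> above 0 p"

lemma schroeder_paths_iff: "p \<in> schroeder_paths n \<longleftrightarrow> end_point p = (2 * int n, 0) \<and> balanced p"
  by (auto simp: schroeder_paths_def balanced_def above_def height_def)

lemma balanced_simps [simp]:
  "balanced []"
  "balanced (H # p) \<longleftrightarrow> balanced p"
  "\<not> balanced (D # p)"
  by (auto simp: balanced_def above_Cons dest: above_nonneg)

lemma balanced_append: "balanced p \<Longrightarrow> balanced (p @ q) \<longleftrightarrow> balanced q"
  by (auto simp: balanced_def above_append)

lemma balanced_U: "balanced p \<Longrightarrow> balanced (U # p @ D # q) \<longleftrightarrow> balanced q"
  by (auto simp: balanced_def above_append above_Cons intro: above_mono[of 0])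

lemma balanced_cases [consumes 1, case_names Nil H U]:
  assumes "balanced p"
  obtains "p = []"
    | q where "p = H # q" "balanced q"
    | q r where "p = U # q @ D # r" "balanced q" "balanced r"
proof (cases p)
  case (Cons s p')
  show ?thesis
  proof (cases s)
    case U
    with assms Cons have p': "height p' = - 1" by (simp add: balanced_def)
    then have "\<not> above 0 p'" by (auto simp: above_def)
    then obtain q r where qr: "p' = q @ D # r" "height q = 0" "above 0 q"
      using first_descent_exists by blast
    then have "balanced q" by (simp add: balanced_def)
    with that(3)[of q r] assms Cons U qr show ?thesis by (simp add: balanced_U)
  qed (use assms Cons that in auto)
qed (use that in simp)

lemma balanced_induct [consumes 1, case_names Nil H U]:
  assumes "balanced p"
    and "P []"
    and "\<And>q. balanced q \<Longrightarrow> P q \<Longrightarrow> P (H # q)"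
    and "\<And>q r. balanced q \<Longrightarrow> P q \<Longrightarrow> balanced r \<Longrightarrow> P r \<Longrightarrow> P (U # q @ D # r)"
  shows "P p"
  using assms(1)
proof (induction "length p" arbitrary: p rule: less_induct)
  case less
  from less.prems show ?case
    by (cases rule: balanced_cases) (use less.hyps assms(2-4) in auto)
qed

text \<open>The start level \<open>h\<close> lets the peak condition pass to factors of a longer
  path.\<close>

definition peaks_odd :: "int \<Rightarrow> step list \<Rightarrow> bool" where
  "peaks_odd h P \<longleftrightarrow> (\<forall>p q. P = p @ [U, D] @ q \<longrightarrow> odd (h + height (p @ [U])))"

lemma no_even_peak_iff: "no_even_peak P \<longleftrightarrow> peaks_odd 0 P"
  by (simp add: no_even_peak_def peaks_odd_def)

lemma peaks_odd_Nil [simp]: "peaks_odd h []"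
  by (simp add: peaks_odd_def)

lemma peaks_odd_Cons:
  "peaks_odd h (s # P) \<longleftrightarrow> (s = U \<and> prefix [D] P \<longrightarrow> even h) \<and> peaks_odd (h + height [s]) P"
proof -
  have "(\<forall>p q. s # P = p @ [U, D] @ q \<longrightarrow> Q p) \<longleftrightarrow>
      (s = U \<and> prefix [D] P \<longrightarrow> Q []) \<and> (\<forall>p q. P = p @ [U, D] @ q \<longrightarrow> Q (s # p))" for Q
    by (auto simp: Cons_eq_append_conv prefix_def)
  moreover have "height ((s # p) @ [U]) = height [s] + height (p @ [U])" for p
    by (cases s) auto
  ultimately show ?thesis
    unfolding peaks_odd_def by (simp only: add.assoc) simp
qed

lemma peaks_odd_simps [simp]:
  "peaks_odd h (H # p) \<longleftrightarrow> peaks_odd h p"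
  "peaks_odd h (D # p) \<longleftrightarrow> peaks_odd (h - 1) p"
  by (simp_all add: peaks_odd_Cons)

lemma peaks_odd_even: "even h \<Longrightarrow> peaks_odd h p \<longleftrightarrow> peaks_odd 0 p"
  by (simp add: peaks_odd_def)

lemma prefix_D_balanced: "balanced p \<Longrightarrow> prefix [D] (p @ D # q) \<longleftrightarrow> p = []"
  by (cases p) auto

text \<open>A balanced path never ends in \<open>U\<close>, so no peak straddles the junction, and
  \<open>q\<close> starts again at level \<open>h\<close>.\<close>

lemma peaks_odd_append:
  "balanced p \<Longrightarrow> peaks_odd h (p @ q) \<longleftrightarrow> peaks_odd h p \<and> peaks_odd h q"
proof (induction p arbitrary: h q rule: balanced_induct)
  case (U p r)
  then show ?case
    by (simp add: peaks_odd_Cons[of h U] prefix_D_balanced)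
qed simp_all

lemma peaks_odd_U:
  "balanced p \<Longrightarrow> peaks_odd h (U # p @ D # q) \<longleftrightarrow>
     (p = [] \<longrightarrow> even h) \<and> peaks_odd (h + 1) p \<and> peaks_odd h q"
  by (simp add: peaks_odd_Cons[of h U] prefix_D_balanced peaks_odd_append)

text \<open>The factor P_i' in the definition of \<open>psi\<close>, where \<open>p\<close> is the
  image of P_i.\<close>

definition item :: "step list \<Rightarrow> step list" where
  "item p = (if p = [] then [H] else U # p @ [D])"

abbreviation items :: "step list list \<Rightarrow> step list" where
  "items ps \<equiv> concat (map item ps)"

lemma balanced_item: "balanced p \<Longrightarrow> balanced (item p)"
  by (simp add: item_def balanced_U)

lemma balanced_items: "\<forall>p\<in>set ps. balanced p \<Longrightarrow> balanced (items ps)"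
  by (induction ps) (simp_all add: balanced_append balanced_item)

text \<open>Inside an item \<open>p\<close> starts at level 2, of the same parity as 0; the outer
  steps form no peak, as an empty \<open>p\<close> becomes \<open>H\<close>.\<close>

lemma peaks_odd_items:
  "\<forall>p\<in>set ps. balanced p \<Longrightarrow> peaks_odd 1 (items ps) \<longleftrightarrow> (\<forall>p\<in>set ps. peaks_odd 0 p)"
proof (induction ps)
  case (Cons p ps)
  have "peaks_odd 1 (item p) \<longleftrightarrow> peaks_odd 0 p"
    using Cons.prems by (simp add: item_def peaks_odd_U peaks_odd_even[of 2])
  with Cons show ?case by (simp add: peaks_odd_append balanced_item)
qed simp

text \<open>An arch \<open>U D\<close> at level 1 would be a peak at level 2, so all arches there
  have nonempty interior and are items. The length bound serves the induction in
  \<open>psi_surj\<close>.\<close>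

lemma items_exist:
  assumes "balanced p" "peaks_odd 1 p"
  shows "\<exists>ps. p = items ps \<and> (\<forall>q\<in>set ps. balanced q \<and> length q < length p)"
  using assms
proof (induction rule: balanced_induct)
  case Nil
  then show ?case by (intro exI[of _ "[]"]) simp
next
  case (H q)
  from H.prems have "peaks_odd 1 q" by simp
  with H.IH obtain ps where
    ps: "q = items ps" "\<forall>r\<in>set ps. balanced r \<and> length r < length q" by blast
  from ps(1) have "H # q = items ([] # ps)" by (simp add: item_def)
  moreover have "\<forall>r\<in>set ([] # ps). balanced r \<and> length r < length (H # q)"
    using ps(2) by (simp add: less_SucI)
  ultimately show ?case by blast
next
  case (U q r)
  from U.prems have "q \<noteq> []" "peaks_odd 1 r" using peaks_odd_U[OF U(1), of 1 r] by auto
  with U obtain ps where ps: "r = items ps" "\<forall>s\<in>set ps. balanced s \<and> length s < length r" by blast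
  from ps(1) \<open>q \<noteq> []\<close> have "U # q @ D # r = items (q # ps)" by (simp add: item_def)
  moreover have "length s < length (U # q @ D # r)" if "length s < length r" for s :: "step list"
    using that by simp
  with ps(2) have "\<forall>s\<in>set ps. balanced s \<and> length s < length (U # q @ D # r)" by blast
  with U(1) have "\<forall>s\<in>set (q # ps). balanced s \<and> length s < length (U # q @ D # r)" by simp
  ultimately show ?case by blast
qed

lemma item_neq_Nil: "item p \<noteq> []"
  by (simp add: item_def)

lemma item_append_inj:
  assumes "balanced p" "balanced p'" "item p @ q = item p' @ q'"
  shows "p = p' \<and> q = q'"
proof (cases "p = [] \<or> p' = []")
  case False
  with assms(3) have "p @ D # q = p' @ D # q'" by (simp add: item_def)
  with assms(1,2) show ?thesis
    unfolding balanced_def by (blast dest: first_descent_unique)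
qed (use assms(3) in \<open>auto simp: item_def split: if_splits\<close>)

lemma items_inj:
  assumes "\<forall>p\<in>set ps. balanced p" "\<forall>p\<in>set ps'. balanced p" "items ps = items ps'"
  shows "ps = ps'"
  using assms
proof (induction ps arbitrary: ps')
  case Nil
  then show ?case by (cases ps') (simp_all add: item_neq_Nil)
next
  case (Cons p ps)
  from Cons.prems(3) obtain p' qs where ps': "ps' = p' # qs"
    by (cases ps') (simp_all add: item_neq_Nil)
  with Cons.prems have *: "p = p' \<and> items ps = items qs"
    by (intro item_append_inj) simp_all
  have "ps = qs"
    using Cons.prems * by (intro Cons.IH) (simp_all add: ps')
  with * ps' show ?case by simp
qed


section \<open>The map psi\<close>

lemma UH_free_schroeder_balanced: "UH_free_schroeder p \<longleftrightarrow> balanced p \<and> UH_free p"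
  by (simp add: UH_free_schroeder_iff balanced_def)

text \<open>The third case admits \<open>ps = []\<close>, which merges the last two rules of
  \<open>psi\<close>.\<close>

lemma UH_free_schroeder_cases [consumes 1, case_names Nil H U]:
  assumes "UH_free_schroeder p"
  obtains "p = []"
    | q where "p = H # q" "UH_free_schroeder q"
    | ps q where "p = first_return (length ps + 1) ps q"
        "\<forall>p\<in>set ps. UH_free_schroeder p" "UH_free_schroeder q"
proof (cases p)
  case (Cons s p')
  show ?thesis
  proof (cases s)
    case U
    with assms Cons first_return_exists[of p'] that(3) show ?thesis by blast
  next
    case H
    with assms Cons that(2)[of p'] show ?thesis by (simp add: UH_free_schroeder_simps)
  qed (use assms Cons in \<open>simp add: UH_free_schroeder_balanced\<close>)
qed (use that in simp)

lemma length_le_concat_D: "p \<in> set ps \<Longrightarrow> length p \<le> length (concat (map (\<lambda>p. D # p) ps))"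
  by (induction ps) auto

lemma UH_free_schroeder_induct [consumes 1, case_names Nil H U]:
  assumes "UH_free_schroeder p"
    and "P []"
    and "\<And>q. UH_free_schroeder q \<Longrightarrow> P q \<Longrightarrow> P (H # q)"
    and "\<And>ps q. \<forall>p\<in>set ps. UH_free_schroeder p \<Longrightarrow> (\<And>p. p \<in> set ps \<Longrightarrow> P p) \<Longrightarrow>
      UH_free_schroeder q \<Longrightarrow> P q \<Longrightarrow> P (first_return (length ps + 1) ps q)"
  shows "P p"
  using assms(1)
proof (induction "length p" arbitrary: p rule: less_induct)
  case less
  from less.prems show ?case
  proof (cases rule: UH_free_schroeder_cases)
    case (U ps q)
    have "length r < length p" if "r \<in> set ps" for r
      using length_le_concat_D[OF that] U(1) by (simp del: length_concat)
    moreover have "length q < length p" using U(1) by simp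
    ultimately show ?thesis using less.hyps U assms(4) by blast
  qed (use less.hyps assms(2,3) in auto)
qed

text \<open>This reconciles \<open>psi\<close>, which tests whether a factor is empty, with
  \<open>item\<close>, which tests its image.\<close>

lemma psi_eq_Nil_iff:
  assumes "UH_free_schroeder p"
  shows "psi p = [] \<longleftrightarrow> p = []"
proof (cases p rule: psi.cases)
  case (4 ps q)
  then show ?thesis using psi.simps(4)[OF 4(1-3)] by (simp only:) simp
qed (use assms in auto)

lemma psi_first_return:
  assumes "\<forall>p\<in>set ps. UH_free_schroeder p" "UH_free_schroeder q"
  shows "psi (first_return (length ps + 1) ps q) = U # items (map psi ps) @ D # psi q"
proof (cases "ps = []")
  case False
  have "map (\<lambda>P. if P = [] then [H] else U # psi P @ [D]) ps = map item (map psi ps)"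
    using assms(1) by (auto simp: item_def psi_eq_Nil_iff)
  with psi.simps(4)[OF False assms] show ?thesis by simp
qed (use assms in simp)

lemma balanced_psi: "UH_free_schroeder p \<Longrightarrow> balanced (psi p)"
proof (induction rule: UH_free_schroeder_induct)
  case (U ps q)
  then show ?case
    unfolding psi_first_return[OF U.hyps] by (simp add: balanced_U balanced_items del: map_map)
qed simp_all

text \<open>The items start at level 1, where \<open>peaks_odd_items\<close> applies; without items
  the arch is a peak at the odd level 1.\<close>

lemma peaks_odd_psi: "UH_free_schroeder p \<Longrightarrow> peaks_odd 0 (psi p)"
proof (induction rule: UH_free_schroeder_induct)
  case (U ps q)
  then show ?case
    unfolding psi_first_return[OF U.hyps]
    by (subst peaks_odd_U) (auto intro!: balanced_items balanced_psi simp: peaks_odd_items balanced_psi simp del: map_map)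
qed simp_all

section \<open>Preservation of the semilength by \<open>psi\<close>\<close>

lemma end_point_items:
  "end_point (items ps) = (\<Sum>p\<leftarrow>ps. (2, 0) + end_point p)"
proof (induction ps)
  case (Cons p ps)
  have "end_point (item p) = (2, 0) + end_point p"
    by (cases "end_point p") (auto simp: item_def end_point_append end_point_Cons end_point_Nil zero_prod_def)
  with Cons show ?case by (simp add: end_point_append)
qed (simp add: end_point_Nil)

text \<open>Each down step is paired with one of the initial up steps, giving (2, 0), the same as
  the outer steps of an item.\<close>

lemma end_point_first_return:
  "end_point (first_return (length ps + 1) ps q) =
     (2, 0) + (\<Sum>p\<leftarrow>ps. (2, 0) + end_point p) + end_point q"
proof -
  have "end_point (concat (map (\<lambda>P. D # P) ps)) + (int (length ps), int (length ps)) =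
      (\<Sum>p\<leftarrow>ps. (2, 0) + end_point p)"
  proof (induction ps)
    case (Cons p ps)
    from this[symmetric] show ?case
      by (cases "end_point p"; cases "end_point (concat (map (\<lambda>P. D # P) ps))")
        (auto simp: end_point_append end_point_Cons algebra_simps)
  qed (simp add: end_point_Nil zero_prod_def)
  from this[symmetric] show ?thesis
    by (cases "end_point q"; cases "end_point (concat (map (\<lambda>P. D # P) ps))")
      (simp only: end_point_append end_point_Cons end_point_replicate_U, simp)
qed

lemma end_point_psi: "UH_free_schroeder p \<Longrightarrow> end_point (psi p) = end_point p"
proof (induction rule: UH_free_schroeder_induct)
  case (U ps q)
  have "(\<Sum>p\<leftarrow>map psi ps. (2, 0) + end_point p) = (\<Sum>p\<leftarrow>ps. (2, 0) + end_point p)"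
    using U.IH(1) by (auto simp: comp_def intro!: arg_cong[where f = sum_list])
  then show ?case
    unfolding psi_first_return[OF U.hyps] end_point_first_return
    using U.IH(2) by (cases "end_point q"; cases "\<Sum>p\<leftarrow>ps. (2, 0) + end_point p")
      (simp add: end_point_append end_point_Cons end_point_items del: map_map)
qed (simp_all add: end_point_Cons)

text \<open>The first step identifies the rule, the first return separates the items from
  \<open>psi q\<close>, and the items determine the images of the factors.\<close>

lemma psi_inj:
  assumes "UH_free_schroeder p" "UH_free_schroeder p'" "psi p = psi p'"
  shows "p = p'"
  using assms
proof (induction arbitrary: p' rule: UH_free_schroeder_induct)
  case Nil
  then show ?case using psi_eq_Nil_iff[of p'] by simp
next
  case (H q)
  from H.prems(1) show ?case
    by (cases rule: UH_free_schroeder_cases) (use H psi_first_return in auto)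
next
  case (U ps q)
  note hyps = U.hyps and IH = U.IH(1) and IHq = U.IH(2)
  have psi: "psi p' = U # items (map psi ps) @ D # psi q"
    using U.prems(2) psi_first_return[OF U.hyps] by simp
  from U.prems(1) show ?case
  proof (cases rule: UH_free_schroeder_cases)
    case (U ps' q')
    have bal: "balanced (items (map psi ps))" "balanced (items (map psi ps'))"
      using hyps(1) U(2) by (auto intro!: balanced_items balanced_psi simp del: map_map)
    have "items (map psi ps) @ D # psi q = items (map psi ps') @ D # psi q'"
      using psi psi_first_return[OF U(2,3)] U(1) by simp
    then have eq: "items (map psi ps) = items (map psi ps')" "psi q = psi q'"
      using first_descent_unique bal unfolding balanced_def by blast+
    have "map psi ps = map psi ps'"
      by (rule items_inj) (use hyps(1) U(2) eq(1) balanced_psi in auto)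
    then have "ps = ps'"
      using IH U(2) by (auto simp: list_eq_iff_nth_eq)
    with U eq(2) IHq show ?thesis by simp
  qed (use psi in auto)
qed

text \<open>The interior of the first arch starts at level 1, so \<open>items_exist\<close> splits
  it; the entries and the rest are shorter and have preimages, which are reassembled by
  \<open>first_return\<close>.\<close>

lemma psi_surj:
  assumes "balanced r" "peaks_odd 0 r"
  shows "\<exists>p. UH_free_schroeder p \<and> psi p = r"
  using assms
proof (induction "length r" arbitrary: r rule: less_induct)
  case less
  from less.prems(1) show ?case
  proof (cases rule: balanced_cases)
    case Nil
    then show ?thesis by (intro exI[of _ "[]"]) (simp add: UH_free_schroeder_simps)
  next
    case (H q)
    with less obtain p where "UH_free_schroeder p" "psi p = q" by auto
    with H show ?thesis by (intro exI[of _ "H # p"]) (simp add: UH_free_schroeder_simps)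
  next
    case (U x y)
    with less.prems(2) have odd: "peaks_odd 1 x" "peaks_odd 0 y" by (auto simp: peaks_odd_U)
    have "length y < length r" using U(1) by simp
    with U(3) odd(2) less.hyps obtain q where q: "UH_free_schroeder q" "psi q = y" by blast
    obtain zs where zs: "x = items zs" "\<forall>z\<in>set zs. balanced z \<and> length z < length x"
      using items_exist U(2) odd(1) by blast
    with odd(1) have "\<forall>z\<in>set zs. peaks_odd 0 z" by (simp add: peaks_odd_items)
    moreover have "length z < length r" if "length z < length x" for z :: "step list"
      using that U(1) by simp
    ultimately have "\<forall>z\<in>set zs. \<exists>p. UH_free_schroeder p \<and> psi p = z"
      using zs(2) less.hyps by blast
    then obtain f where f: "\<forall>z\<in>set zs. UH_free_schroeder (f z) \<and> psi (f z) = z" by metis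
    then have *: "\<forall>p\<in>set (map f zs). UH_free_schroeder p" "map psi (map f zs) = zs"
      by (auto intro: map_idI)
    show ?thesis
      using UH_free_schroeder_first_return[OF *(1) q(1)] psi_first_return[OF *(1) q(1)] U(1)
      unfolding *(2) q(2) zs(1) by blast
  qed
qed

lemma bij_betw_psi:
  "bij_betw psi {p \<in> schroeder_paths n. UH_free p} {P \<in> schroeder_paths n. no_even_peak P}"
proof (rule bij_betwI')
  show "psi p = psi p' \<longleftrightarrow> p = p'"
    if "p \<in> {p \<in> schroeder_paths n. UH_free p}" "p' \<in> {p \<in> schroeder_paths n. UH_free p}" for p p'
    using that psi_inj unfolding UH_free_schroeder_def by blast
  show "psi p \<in> {P \<in> schroeder_paths n. no_even_peak P}"
    if "p \<in> {p \<in> schroeder_paths n. UH_free p}" for p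
    using that balanced_psi[of p] peaks_odd_psi[of p] end_point_psi[of p]
    by (simp add: schroeder_paths_iff UH_free_schroeder_balanced no_even_peak_iff)
  show "\<exists>p\<in>{p \<in> schroeder_paths n. UH_free p}. r = psi p"
    if "r \<in> {P \<in> schroeder_paths n. no_even_peak P}" for r
  proof -
    from that obtain p where p: "UH_free_schroeder p" "psi p = r"
      using psi_surj by (auto simp: schroeder_paths_iff no_even_peak_iff)
    with that end_point_psi[of p] show ?thesis
      by (intro bexI[of _ p]) (auto simp: schroeder_paths_iff UH_free_schroeder_balanced)
  qed
qed

theorem theorem5:
  fixes n :: nat
  shows "bij_betw (psi \<circ> sigma n)
           (avoiding_partitions (n + 1) [1, 2, 3, 1, 2])
           {P \<in> schroeder_paths n. no_even_peak P}
       \<and> bij_betw (psi \<circ> phi n)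
           (avoiding_partitions (n + 1) [1, 2, 3, 2, 1])
           {P \<in> schroeder_paths n. no_even_peak P}"
  using bij_betw_trans[OF bij_betw_sigma bij_betw_psi]
    bij_betw_trans[OF bij_betw_phi bij_betw_psi] by blast

end
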